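(* Let $S,S'\subset\mathbb{R}^n$ be finite exact sets. Then (1) all points of $S$ are vertices of $\mathrm{conv}(S)$; (2) the set of vertices of any face of $\mathrm{conv}(S)$ is again exact; (3) the product $S\times S'$ is exact; and (4) $\mathrm{conv}(S)$ is affinely equivalent to a $0/1$ polytope (a polytope all of whose vertices have coordinates in $\{0,1\}$).
   Context: A polynomial in $\mathbb{R}[\mathbf{x}]=\mathbb{R}[x_1,\ldots,x_n]$ is linear if it has degree at most $1$. For an ideal $I\subseteq\mathbb{R}[\mathbf{x}]$, $f$ is $1$-sos mod $I$ if there are linear polynomials $h_1,\ldots,h_t$ with $f-\sum_j h_j^2\in I$, and $\mathrm{TH}_1(I):=\{\mathbf{x}\in\mathbb{R}^n : f(\mathbf{x})\ge0\text{ for every linear } f\text{ that is }1\text{-sos mod } I\}$. A finite set $S\subset\mathbb{R}^n$ is exact if its vanishing ideal $\mathcal{I}(S)$ (all polynomials vanishing on $S$) is $\mathrm{TH}_1$-exact, i.e., $\mathrm{TH}_1(\mathcal{I}(S))=\mathrm{conv}(S)$. *)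

theory Defs
  imports "HOL-Analysis.Analysis" "HOL-Library.Poly_Mapping"
begin

text \<open>The ring \<open>\<real>[x\<^sub>1, \<dots>, x\<^sub>n]\<close>, with the variables indexed by the type \<open>'n\<close> that also indexes
  the coordinates of \<open>real ^ 'n\<close>: a polynomial maps finitely many exponent vectors to non-zero
  coefficients.  Multiplication is convolution, as provided by \<open>Poly_Mapping\<close>.\<close>
type_synonym 'n mpoly = "('n \<Rightarrow>\<^sub>0 nat) \<Rightarrow>\<^sub>0 real"

definition mpoly_eval :: "'n::finite mpoly \<Rightarrow> real ^ 'n \<Rightarrow> real" where
  "mpoly_eval p x =
    (\<Sum>m\<in>Poly_Mapping.keys p.
      Poly_Mapping.lookup p m * (\<Prod>i\<in>UNIV. (x $ i) ^ Poly_Mapping.lookup m i))"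

text \<open>The zero polynomial is given degree 0, so it counts as linear.\<close>
definition mpoly_degree :: "'n::finite mpoly \<Rightarrow> nat" where
  "mpoly_degree p =
    Max (insert 0 ((\<lambda>m. \<Sum>i\<in>UNIV. Poly_Mapping.lookup m i) ` Poly_Mapping.keys p))"

definition linear_mpoly :: "'n::finite mpoly \<Rightarrow> bool" where
  "linear_mpoly p \<longleftrightarrow> mpoly_degree p \<le> 1"

definition one_sos_mod :: "'n::finite mpoly \<Rightarrow> 'n mpoly set \<Rightarrow> bool" where
  "one_sos_mod f I \<longleftrightarrow>
    (\<exists>(t::nat) (h :: nat \<Rightarrow> 'n mpoly).
      (\<forall>j<t. linear_mpoly (h j)) \<and> f - (\<Sum>j<t. (h j)\<^sup>2) \<in> I)"

definition TH1 :: "'n::finite mpoly set \<Rightarrow> (real ^ 'n) set" where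
  "TH1 I = {x. \<forall>f. linear_mpoly f \<and> one_sos_mod f I \<longrightarrow> mpoly_eval f x \<ge> 0}"

definition vanishing_ideal :: "(real ^ 'n::finite) set \<Rightarrow> 'n mpoly set" where
  "vanishing_ideal S = {p. \<forall>x\<in>S. mpoly_eval p x = 0}"

definition exact_set :: "(real ^ 'n::finite) set \<Rightarrow> bool" where
  "exact_set S \<longleftrightarrow> finite S \<and> TH1 (vanishing_ideal S) = convex hull S"

text \<open>The Cartesian product, as a subset of \<open>\<real>\<^bsup>n+m\<^esup>\<close> (index type \<open>'n + 'm\<close>) rather than of a
  product type, so that exactness applies to it.\<close>
definition vec_append :: "real ^ 'n::finite \<Rightarrow> real ^ 'm::finite \<Rightarrow> real ^ ('n + 'm)" where
  "vec_append x y = (\<chi> i. case i of Inl a \<Rightarrow> x $ a | Inr b \<Rightarrow> y $ b)"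

definition vec_Times ::
  "(real ^ 'n::finite) set \<Rightarrow> (real ^ 'm::finite) set \<Rightarrow> (real ^ ('n + 'm)) set" where
  "vec_Times S S' = {vec_append x y | x y. x \<in> S \<and> y \<in> S'}"

definition vertices :: "'a::real_vector set \<Rightarrow> 'a set" where
  "vertices P = {v. v extreme_point_of P}"

definition zero_one_polytope :: "(real ^ 'n::finite) set \<Rightarrow> bool" where
  "zero_one_polytope Q \<longleftrightarrow> polytope Q \<and> (\<forall>v\<in>vertices Q. \<forall>i. v $ i \<in> {0, 1})"

text \<open>The affine map of the ambient spaces need only be bijective between the two sets, which
  may be lower-dimensional.\<close>
definition affinely_equivalent :: "'a::real_vector set \<Rightarrow> 'b::real_vector set \<Rightarrow> bool" where
  "affinely_equivalent P Q \<longleftrightarrow>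
    (\<exists>L c. linear L \<and> bij_betw (\<lambda>x. L x + c) P Q)"

end

theory Submission imports Defs begin

text \<open>Evaluation is a ring homomorphism and linear polynomials are the affine functions
  \<open>a \<bullet> x + b\<close>, so membership in \<open>TH1\<close> of a vanishing ideal is a statement about
  affine functions that agree on \<open>S\<close> with a sum of squares of affine functions.  Faces are exposed
  and their supporting functional, vanishing on \<open>S \<inter> F\<close>, is a sum of squares there up to sign;
  products follow by projecting to the factors.

  For the remaining parts the key point is that a functional defining a facet takes only two values
  on an exact set \<open>S\<close>.  Suppose two points of \<open>S\<close> lie at distances in the ratio
  \<open>r \<in> {0<..<1}\<close> from the facet.  Put weight \<open>-1\<close> on the nearer one, a weight \<open>k\<close> with
  \<open>r\<^sup>2 < k < r\<close> on the farther one, and a large positive weight on the points of the facet.  Squares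
  of affine functions still have non-negative weighted sums, so the barycentre lies in \<open>TH1\<close>; but
  since \<open>k < r\<close> it lies strictly beyond the facet, contradicting exactness.  Every line in the affine
  hull of \<open>S\<close> through a relatively interior point leaves the polytope through a facet, so the facet
  functionals, normalised to the values 0 and 1 on \<open>S\<close>, separate points: they map \<open>conv S\<close>
  injectively into a cube and \<open>S\<close> to vertices of it.\<close>

section \<open>Evaluation as a ring homomorphism\<close>

lemma mpoly_eval_0 [simp]: "mpoly_eval 0 x = 0"
  by (simp add: mpoly_eval_def)

lemma mpoly_eval_add: "mpoly_eval (p + q) x = mpoly_eval p x + mpoly_eval q x"
  unfolding mpoly_eval_def
  by (rule setsum_keys_plus_distrib) (simp_all add: distrib_right)

lemma mpoly_eval_uminus: "mpoly_eval (- p) x = - mpoly_eval p x"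
  using mpoly_eval_add [of p "- p" x] by simp

lemma mpoly_eval_diff: "mpoly_eval (p - q) x = mpoly_eval p x - mpoly_eval q x"
  using mpoly_eval_add [of p "- q" x] by (simp add: mpoly_eval_uminus)

lemma mpoly_eval_sum: "mpoly_eval (sum p A) x = (\<Sum>i\<in>A. mpoly_eval (p i) x)"
  by (induction A rule: infinite_finite_induct) (simp_all add: mpoly_eval_add)

lemma mpoly_eval_single:
  "mpoly_eval (Poly_Mapping.single m c) x = c * (\<Prod>i\<in>UNIV. (x $ i) ^ Poly_Mapping.lookup m i)"
  by (simp add: mpoly_eval_def)

text \<open>Updating at a fresh key amounts to adding a single term, so additivity of evaluation
  becomes usable in the induction step.\<close>

lemma poly_mapping_single_induct [case_names zero add]:
  assumes zero: "P 0"
    and add: "\<And>p m c. P p \<Longrightarrow> P (p + Poly_Mapping.single m c)"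
  shows "P p"
proof (induction p rule: update_induct)
  case (update f a b)
  have "Poly_Mapping.update a b f = f + Poly_Mapping.single a b"
    using update.hyps(1)
    by (intro poly_mapping_eqI)
      (auto simp: lookup_update lookup_add lookup_single when_def in_keys_iff)
  then show ?case
    using add update.IH by simp
qed (rule zero)

text \<open>Convolution is bilinear, so induction on each factor leaves only a product of two
  monomials, whose exponents add.\<close>

lemma mpoly_eval_mult: "mpoly_eval (p * q) x = mpoly_eval p x * mpoly_eval q x"
proof (induction p rule: poly_mapping_single_induct)
  case (add p m c)
  have "mpoly_eval (Poly_Mapping.single m c * q) x = mpoly_eval (Poly_Mapping.single m c) x * mpoly_eval q x"
    by (induction q rule: poly_mapping_single_induct)
      (simp_all add: distrib_left mpoly_eval_add mult_single mpoly_eval_single lookup_add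
        power_add prod.distrib mult_ac)
  with add show ?case
    by (simp add: distrib_right mpoly_eval_add)
qed simp

lemma mpoly_eval_power2: "mpoly_eval (p\<^sup>2) x = (mpoly_eval p x)\<^sup>2"
  by (simp add: power2_eq_square mpoly_eval_mult)

section \<open>Linear polynomials as affine functions\<close>

lemma linear_mpoly_iff:
  "linear_mpoly p \<longleftrightarrow> (\<forall>m\<in>Poly_Mapping.keys p. (\<Sum>i\<in>UNIV. Poly_Mapping.lookup m i) \<le> 1)"
  by (simp add: linear_mpoly_def mpoly_degree_def)

lemma affine_imp_mpoly:
  fixes a :: "real ^ 'n::finite"
  obtains p where "linear_mpoly p" "\<And>x. mpoly_eval p x = a \<bullet> x + b"
proof
  define var :: "'n \<Rightarrow> 'n \<Rightarrow>\<^sub>0 nat" where "var i = Poly_Mapping.single i 1" for i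
  define p where "p = (\<Sum>i\<in>UNIV. Poly_Mapping.single (var i) (a $ i)) + Poly_Mapping.single 0 b"
  \<comment> \<open>Only an inclusion of keys holds, since \<open>b\<close> or some
    \<open>a $ i\<close> may vanish; it is enough for the degree bound.\<close>
  have *: "m = 0 \<or> (\<exists>i. m = var i)" if "m \<in> Poly_Mapping.keys p" for m
  proof (rule ccontr)
    assume "\<not> ?thesis"
    then have "m \<noteq> 0" "\<And>i. var i \<noteq> m"
      by auto
    then have "Poly_Mapping.lookup p m = 0"
      by (simp add: p_def lookup_add lookup_sum lookup_single when_def)
    with that show False
      by (simp add: in_keys_iff)
  qed
  have "(\<Sum>j\<in>UNIV. Poly_Mapping.lookup (var i) j) = 1" for i
    by (simp add: var_def lookup_single when_def)
  then show "linear_mpoly p"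
    using * by (force simp: linear_mpoly_iff)
  have "(\<Prod>j\<in>UNIV. (x $ j) ^ Poly_Mapping.lookup (var i) j) = x $ i" for i and x :: "real ^ 'n"
  proof -
    have "(\<Prod>j\<in>UNIV. (x $ j) ^ Poly_Mapping.lookup (var i) j) = (\<Prod>j\<in>UNIV. if i = j then x $ j else 1)"
      by (intro prod.cong) (auto simp: var_def lookup_single when_def)
    then show ?thesis
      by simp
  qed
  then show "mpoly_eval p x = a \<bullet> x + b" for x
    by (simp add: p_def mpoly_eval_add mpoly_eval_sum mpoly_eval_single inner_vec_def)
qed

text \<open>Total degree at most 1 leaves monomials with no variable or a single one to the first
  power, and both evaluate to affine functions.\<close>

lemma linear_mpoly_imp_affine:
  fixes p :: "'n::finite mpoly"
  assumes "linear_mpoly p"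
  obtains a b where "\<And>x. mpoly_eval p x = a \<bullet> x + b"
proof -
  have mono: "\<exists>a b. \<forall>x::real^'n. (\<Prod>i\<in>UNIV. (x $ i) ^ Poly_Mapping.lookup m i) = a \<bullet> x + b"
    if m: "m \<in> Poly_Mapping.keys p" for m
  proof (cases "\<exists>i. Poly_Mapping.lookup m i \<noteq> 0")
    case True
    then obtain i where i: "Poly_Mapping.lookup m i \<noteq> 0"
      by blast
    have "(\<Sum>j\<in>UNIV. Poly_Mapping.lookup m j) =
        Poly_Mapping.lookup m i + (\<Sum>j\<in>UNIV - {i}. Poly_Mapping.lookup m j)"
      by (simp add: sum.remove)
    moreover have "(\<Sum>j\<in>UNIV. Poly_Mapping.lookup m j) \<le> 1"
      using assms m by (simp add: linear_mpoly_iff)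
    ultimately have "Poly_Mapping.lookup m i = 1" "(\<Sum>j\<in>UNIV - {i}. Poly_Mapping.lookup m j) = 0"
      using i by linarith+
    then have "Poly_Mapping.lookup m i = 1" "\<And>j. j \<noteq> i \<Longrightarrow> Poly_Mapping.lookup m j = 0"
      by auto
    then have "(\<Prod>j\<in>UNIV. (x $ j) ^ Poly_Mapping.lookup m j) = (\<Prod>j\<in>UNIV. if i = j then x $ j else 1)"
      for x :: "real ^ 'n"
      by (intro prod.cong) auto
    then have "(\<Prod>j\<in>UNIV. (x $ j) ^ Poly_Mapping.lookup m j) = axis i 1 \<bullet> x + 0" for x :: "real ^ 'n"
      by (simp add: inner_axis')
    then show ?thesis
      by blast
  next
    case False
    then have "\<forall>x::real^'n. (\<Prod>i\<in>UNIV. (x $ i) ^ Poly_Mapping.lookup m i) = 0 \<bullet> x + 1"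
      by simp
    then show ?thesis
      by blast
  qed
  then obtain a b where ab: "\<And>m (x::real^'n). m \<in> Poly_Mapping.keys p \<Longrightarrow>
      (\<Prod>i\<in>UNIV. (x $ i) ^ Poly_Mapping.lookup m i) = a m \<bullet> x + b m"
    by metis
  have "mpoly_eval p x = (\<Sum>m\<in>Poly_Mapping.keys p. Poly_Mapping.lookup p m *\<^sub>R a m) \<bullet> x
      + (\<Sum>m\<in>Poly_Mapping.keys p. Poly_Mapping.lookup p m * b m)" for x
    unfolding mpoly_eval_def
    by (simp add: ab inner_sum_left distrib_left sum.distrib)
  then show thesis
    by (rule that)
qed

section \<open>Affine certificates for \<open>TH1\<close> of a vanishing ideal\<close>

text \<open>Equality is required on \<open>S\<close> only, because polynomials are congruent modulo
  the vanishing ideal exactly when they agree on \<open>S\<close>.\<close>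

definition affine_sos_on :: "'a::real_inner set \<Rightarrow> ('a \<Rightarrow> real) \<Rightarrow> bool" where
  "affine_sos_on S f \<longleftrightarrow>
    (\<exists>(t::nat) c d. \<forall>s\<in>S. f s = (\<Sum>j<t. (c j \<bullet> s + d j)\<^sup>2))"

lemma one_sos_mod_vanishing_ideal:
  "one_sos_mod f (vanishing_ideal S) \<longleftrightarrow> affine_sos_on S (mpoly_eval f)"
proof
  assume "one_sos_mod f (vanishing_ideal S)"
  then obtain t :: nat and h where h: "\<And>j. j < t \<Longrightarrow> linear_mpoly (h j)"
      and f: "f - (\<Sum>j<t. (h j)\<^sup>2) \<in> vanishing_ideal S"
    unfolding one_sos_mod_def by blast
  have "\<forall>j. \<exists>a b. j < t \<longrightarrow> (\<forall>x. mpoly_eval (h j) x = a \<bullet> x + b)"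
    using h linear_mpoly_imp_affine by metis
  then obtain c d where cd: "\<And>j x. j < t \<Longrightarrow> mpoly_eval (h j) x = c j \<bullet> x + d j"
    by metis
  have "mpoly_eval f s = (\<Sum>j<t. (c j \<bullet> s + d j)\<^sup>2)" if "s \<in> S" for s
    using f that
    by (simp add: vanishing_ideal_def mpoly_eval_diff mpoly_eval_sum mpoly_eval_power2 cd)
  then show "affine_sos_on S (mpoly_eval f)"
    unfolding affine_sos_on_def by blast
next
  assume "affine_sos_on S (mpoly_eval f)"
  then obtain t :: nat and c d where f: "\<And>s. s \<in> S \<Longrightarrow> mpoly_eval f s = (\<Sum>j<t. (c j \<bullet> s + d j)\<^sup>2)"
    unfolding affine_sos_on_def by blast
  have "\<forall>j. \<exists>p. linear_mpoly p \<and> (\<forall>x. mpoly_eval p x = c j \<bullet> x + d j)"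
    using affine_imp_mpoly by metis
  then obtain h where h: "\<And>j. linear_mpoly (h j)" "\<And>j x. mpoly_eval (h j) x = c j \<bullet> x + d j"
    by metis
  have "f - (\<Sum>j<t. (h j)\<^sup>2) \<in> vanishing_ideal S"
    using f by (simp add: vanishing_ideal_def mpoly_eval_diff mpoly_eval_sum mpoly_eval_power2 h)
  with h show "one_sos_mod f (vanishing_ideal S)"
    unfolding one_sos_mod_def by blast
qed

lemma mem_TH1_vanishing_ideal:
  "x \<in> TH1 (vanishing_ideal S) \<longleftrightarrow>
    (\<forall>a b. affine_sos_on S (\<lambda>s. a \<bullet> s + b) \<longrightarrow> a \<bullet> x + b \<ge> 0)"
proof
  assume x: "x \<in> TH1 (vanishing_ideal S)"
  show "\<forall>a b. affine_sos_on S (\<lambda>s. a \<bullet> s + b) \<longrightarrow> a \<bullet> x + b \<ge> 0"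
  proof (intro allI impI)
    fix a b assume "affine_sos_on S (\<lambda>s. a \<bullet> s + b)"
    moreover obtain p where p: "linear_mpoly p" "\<And>x. mpoly_eval p x = a \<bullet> x + b"
      using affine_imp_mpoly [of a b] by blast
    moreover have "mpoly_eval p = (\<lambda>s. a \<bullet> s + b)"
      using p by blast
    ultimately show "a \<bullet> x + b \<ge> 0"
      using x by (force simp: TH1_def one_sos_mod_vanishing_ideal)
  qed
next
  assume *: "\<forall>a b. affine_sos_on S (\<lambda>s. a \<bullet> s + b) \<longrightarrow> a \<bullet> x + b \<ge> 0"
  have "mpoly_eval f x \<ge> 0" if f: "linear_mpoly f" "affine_sos_on S (mpoly_eval f)" for f
  proof -
    obtain a b where ab: "\<And>x. mpoly_eval f x = a \<bullet> x + b"
      using linear_mpoly_imp_affine [OF f(1)] by blast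
    then have "mpoly_eval f = (\<lambda>x. a \<bullet> x + b)"
      by blast
    with f(2) * ab show ?thesis
      by simp
  qed
  then show "x \<in> TH1 (vanishing_ideal S)"
    by (simp add: TH1_def one_sos_mod_vanishing_ideal)
qed

text \<open>A certificate on \<open>T\<close> pulls back along \<open>g\<close>, its linear parts
  being transported by the adjoint. With the identity this gives monotonicity; with projections it
  handles products.\<close>

lemma TH1_linear_image:
  fixes g :: "real ^ 'n::finite \<Rightarrow> real ^ 'm::finite"
  assumes g: "linear g" "g ` S \<subseteq> T" and x: "x \<in> TH1 (vanishing_ideal S)"
  shows "g x \<in> TH1 (vanishing_ideal T)"
  unfolding mem_TH1_vanishing_ideal
proof (intro allI impI)
  fix a b assume "affine_sos_on T (\<lambda>s. a \<bullet> s + b)"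
  then obtain t :: nat and c d where "\<And>s. s \<in> T \<Longrightarrow> a \<bullet> s + b = (\<Sum>j<t. (c j \<bullet> s + d j)\<^sup>2)"
    unfolding affine_sos_on_def by blast
  then have "adjoint g a \<bullet> s + b = (\<Sum>j<t. (adjoint g (c j) \<bullet> s + d j)\<^sup>2)" if "s \<in> S" for s
    using g that by (force simp: adjoint_clauses)
  then have "affine_sos_on S (\<lambda>s. adjoint g a \<bullet> s + b)"
    unfolding affine_sos_on_def
    by (intro exI [of _ t] exI [of _ "\<lambda>j. adjoint g (c j)"] exI [of _ d]) blast
  then have "adjoint g a \<bullet> x + b \<ge> 0"
    using x unfolding mem_TH1_vanishing_ideal by blast
  then show "a \<bullet> g x + b \<ge> 0"
    using g(1) by (simp add: adjoint_clauses)
qed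

lemma affine_sos_on_zero: "(\<And>s. s \<in> S \<Longrightarrow> f s = 0) \<Longrightarrow> affine_sos_on S f"
  unfolding affine_sos_on_def by (intro exI [of _ 0]) simp

lemma convex_hull_affine_le:
  assumes "x \<in> convex hull S" and "\<And>s. s \<in> S \<Longrightarrow> a \<bullet> s \<le> b"
  shows "a \<bullet> x \<le> b"
proof -
  have "convex hull S \<subseteq> {x. a \<bullet> x \<le> b}"
    using assms(2) by (intro hull_minimal) (auto simp: convex_halfspace_le)
  with assms(1) show ?thesis
    by blast
qed

lemma convex_hull_affine_ge:
  assumes "x \<in> convex hull S" and "\<And>s. s \<in> S \<Longrightarrow> a \<bullet> s \<ge> b"
  shows "a \<bullet> x \<ge> b"
  using convex_hull_affine_le [of x S "- a" "- b"] assms by simp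

text \<open>Sums of squares are non-negative on \<open>S\<close>, and affine inequalities pass to
  the hull. Exactness of a finite set thus rests on the reverse inclusion.\<close>

lemma convex_hull_subset_TH1: "convex hull S \<subseteq> TH1 (vanishing_ideal S)"
proof
  fix x assume x: "x \<in> convex hull S"
  have "a \<bullet> x + b \<ge> 0" if "affine_sos_on S (\<lambda>s. a \<bullet> s + b)" for a b
  proof -
    have "a \<bullet> s \<ge> - b" if "s \<in> S" for s
    proof -
      have "a \<bullet> s + b \<ge> 0"
        using \<open>affine_sos_on S _\<close> that unfolding affine_sos_on_def
        by (metis (no_types, lifting) sum_nonneg zero_le_power2)
      then show ?thesis
        by simp
    qed
    then show ?thesis
      using convex_hull_affine_ge [OF x, of "- b" a] by simp
  qed
  then show "x \<in> TH1 (vanishing_ideal S)"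
    by (simp add: mem_TH1_vanishing_ideal)
qed

lemma exact_setI:
  assumes "finite S" and "TH1 (vanishing_ideal S) \<subseteq> convex hull S"
  shows "exact_set S"
  using assms convex_hull_subset_TH1 by (auto simp: exact_set_def)

text \<open>The weights \<open>w\<close> may be negative: they only have to look like a probability measure to
  squares of affine functions.\<close>
lemma signed_moment_in_TH1:
  fixes w :: "real ^ 'n::finite \<Rightarrow> real"
  assumes "finite S" and w: "sum w S = 1"
    and psd: "\<And>c d. (\<Sum>s\<in>S. w s * (c \<bullet> s + d)\<^sup>2) \<ge> 0"
  shows "(\<Sum>s\<in>S. w s *\<^sub>R s) \<in> TH1 (vanishing_ideal S)"
  unfolding mem_TH1_vanishing_ideal
proof (intro allI impI)
  fix a b assume "affine_sos_on S (\<lambda>s. a \<bullet> s + b)"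
  then obtain t :: nat and c d where sos: "\<And>s. s \<in> S \<Longrightarrow> a \<bullet> s + b = (\<Sum>j<t. (c j \<bullet> s + d j)\<^sup>2)"
    unfolding affine_sos_on_def by blast
  have "a \<bullet> (\<Sum>s\<in>S. w s *\<^sub>R s) + b = (\<Sum>s\<in>S. w s * (a \<bullet> s + b))"
    using w by (simp add: inner_sum_right distrib_left sum.distrib flip: sum_distrib_right)
  also have "\<dots> = (\<Sum>s\<in>S. \<Sum>j<t. w s * (c j \<bullet> s + d j)\<^sup>2)"
    by (simp add: sos sum_distrib_left)
  also have "\<dots> = (\<Sum>j<t. \<Sum>s\<in>S. w s * (c j \<bullet> s + d j)\<^sup>2)"
    by (rule sum.swap)
  also have "\<dots> \<ge> 0"
    using psd by (simp add: sum_nonneg)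
  finally show "a \<bullet> (\<Sum>s\<in>S. w s *\<^sub>R s) + b \<ge> 0" .
qed

section \<open>Faces of exact sets\<close>

lemma face_of_convex_hull_eq:
  fixes S :: "'a::euclidean_space set"
  assumes "compact S" and F: "F face_of convex hull S"
  shows "F = convex hull (S \<inter> F)"
proof
  obtain T where "T \<subseteq> S" "F = convex hull T"
    using face_of_convex_hull_subset [OF assms] by blast
  then show "F \<subseteq> convex hull (S \<inter> F)"
    by (metis Int_greatest hull_mono hull_subset)
  show "convex hull (S \<inter> F) \<subseteq> F"
    by (meson F face_of_imp_convex hull_minimal inf_le2)
qed

lemma exact_set_face:
  assumes S: "exact_set S" and F: "F face_of convex hull S"
  shows "exact_set (S \<inter> F)"
proof (rule exact_setI)
  have fin: "finite S" and TH: "TH1 (vanishing_ideal S) = convex hull S"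
    using S by (auto simp: exact_set_def)
  then show "finite (S \<inter> F)"
    by simp
  have "F exposed_face_of convex hull S"
    using exposed_face_of_polyhedron polytope_imp_polyhedron polytope_convex_hull fin F by blast
  then obtain a b where ab: "F = convex hull S \<inter> {x. a \<bullet> x = b}" "convex hull S \<subseteq> {x. a \<bullet> x \<le> b}"
    by (auto simp: exposed_face_of_def)
  have "F = convex hull (S \<inter> F)"
    by (rule face_of_convex_hull_eq [OF finite_imp_compact [OF fin] F])
  moreover have "x \<in> F" if x: "x \<in> TH1 (vanishing_ideal (S \<inter> F))" for x
  proof -
    have "x \<in> convex hull S"
      using TH1_linear_image [OF linear_id _ x, of S] by (simp add: TH)
    moreover have "b \<le> a \<bullet> x"
    proof -
      \<comment> \<open>The functional is non-positive on the whole hull, but on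
        \<open>S \<inter> F\<close> it is the empty sum of squares; this yields the inequality
        opposite to the supporting one.\<close>
      have "affine_sos_on (S \<inter> F) (\<lambda>s. a \<bullet> s + (- b))"
        by (rule affine_sos_on_zero) (simp add: ab(1))
      then have "a \<bullet> x + (- b) \<ge> 0"
        using x unfolding mem_TH1_vanishing_ideal by blast
      then show ?thesis
        by simp
    qed
    ultimately show ?thesis
      using ab by auto
  qed
  ultimately show "TH1 (vanishing_ideal (S \<inter> F)) \<subseteq> convex hull (S \<inter> F)"
    by blast
qed

section \<open>Products of exact sets\<close>

lemma linear_vec_append: "linear (\<lambda>(x, y). vec_append x y)"
  by (auto intro!: linearI simp: vec_eq_iff vec_append_def split: sum.split)

lemma vec_Times_eq_image: "vec_Times S S' = (\<lambda>(x, y). vec_append x y) ` (S \<times> S')"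
  by (auto simp: vec_Times_def)

text \<open>Convex hulls commute with products, so it suffices to test the two projections of a
  point separately.\<close>

lemma exact_vec_Times:
  assumes "exact_set S" "exact_set S'"
  shows "exact_set (vec_Times S S')"
proof (rule exact_setI)
  have fin: "finite S" "finite S'"
    and TH: "TH1 (vanishing_ideal S) = convex hull S" "TH1 (vanishing_ideal S') = convex hull S'"
    using assms by (auto simp: exact_set_def)
  then show "finite (vec_Times S S')"
    by (simp add: vec_Times_eq_image)
  have hull: "convex hull (vec_Times S S') = vec_Times (convex hull S) (convex hull S')"
    unfolding vec_Times_eq_image convex_hull_Times [symmetric]
    by (rule convex_hull_linear_image [OF linear_vec_append, symmetric])
  show "TH1 (vanishing_ideal (vec_Times S S')) \<subseteq> convex hull (vec_Times S S')"
  proof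
    fix z assume z: "z \<in> TH1 (vanishing_ideal (vec_Times S S'))"
    define x y where "x = (\<chi> i. z $ Inl i)" and "y = (\<chi> i. z $ Inr i)"
    have "x \<in> TH1 (vanishing_ideal S)"
      unfolding x_def
      by (rule TH1_linear_image [OF _ _ z])
        (auto intro!: linearI simp: vec_eq_iff vec_Times_def vec_append_def)
    moreover have "y \<in> TH1 (vanishing_ideal S')"
      unfolding y_def
      by (rule TH1_linear_image [OF _ _ z])
        (auto intro!: linearI simp: vec_eq_iff vec_Times_def vec_append_def)
    moreover have "z = vec_append x y"
      by (auto simp: x_def y_def vec_eq_iff vec_append_def split: sum.split)
    ultimately show "z \<in> convex hull (vec_Times S S')"
      unfolding hull TH by (auto simp: vec_Times_def)
  qed
qed

section \<open>Facet functionals take two values on an exact set\<close>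

text \<open>Supplies the weights of the signed measure. \<open>X\<close> and \<open>h\<close> stand
  for the values of an affine function at the farther point and on the facet;
  \<open>r * X + (\<Sum>s\<in>T. u s * h s)\<close> is then its value at the nearer point.\<close>

lemma square_perturbation_bound:
  fixes r :: real
  assumes "0 < r" "r < 1" "finite T"
  shows "\<exists>k M. 0 < k \<and> k < r \<and> 1 < M \<and>
    (\<forall>X h. k * X\<^sup>2 - (r * X + (\<Sum>s\<in>T. u s * h s))\<^sup>2 + M * (\<Sum>s\<in>T. (h s)\<^sup>2) \<ge> 0)"
proof -
  \<comment> \<open>Convexity of the square at \<open>r X + E = t (r X / t) + (1 - t) (E / (1 - t))\<close>; any \<open>t\<close> strictly
    between \<open>r\<close> and 1 works.\<close>
  define t where "t = (1 + r) / 2"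
  define k where "k = r\<^sup>2 / t"
  \<comment> \<open>The quotient absorbs the Cauchy-Schwarz bound on the facet term; the 2 secures
    \<open>1 < M\<close>.\<close>
  define M where "M = (\<Sum>s\<in>T. (u s)\<^sup>2) / (1 - t) + 2"
  have t: "r < t" "0 < t" "t < 1"
    using assms by (auto simp: t_def)
  have "0 < k"
    using assms t by (simp add: k_def)
  moreover have "k < r"
    using assms t by (simp add: k_def power2_eq_square divide_less_eq)
  moreover have "1 < M"
    using t sum_nonneg [of T "\<lambda>s. (u s)\<^sup>2"] by (simp add: M_def add_pos_nonneg)
  moreover have "k * X\<^sup>2 - (r * X + (\<Sum>s\<in>T. u s * h s))\<^sup>2 + M * (\<Sum>s\<in>T. (h s)\<^sup>2) \<ge> 0" for X h
  proof -
    define E where "E = (\<Sum>s\<in>T. u s * h s)"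
    have "E\<^sup>2 \<le> (\<Sum>s\<in>T. (u s)\<^sup>2) * (\<Sum>s\<in>T. (h s)\<^sup>2)"
      unfolding E_def by (rule Cauchy_Schwarz_ineq_sum)
    then have "E\<^sup>2 / (1 - t) \<le> (\<Sum>s\<in>T. (u s)\<^sup>2) * (\<Sum>s\<in>T. (h s)\<^sup>2) / (1 - t)"
      using t by (simp add: divide_right_mono)
    also have "\<dots> \<le> M * (\<Sum>s\<in>T. (h s)\<^sup>2)"
      by (simp add: M_def distrib_right sum_nonneg)
    finally have "E\<^sup>2 / (1 - t) \<le> M * (\<Sum>s\<in>T. (h s)\<^sup>2)" .
    moreover have "r\<^sup>2 / t * X\<^sup>2 + E\<^sup>2 / (1 - t) - (r * X + E)\<^sup>2 = ((1 - t) * r * X - t * E)\<^sup>2 / (t * (1 - t))"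
      using t by (simp add: field_simps power2_eq_square)
    moreover have "((1 - t) * r * X - t * E)\<^sup>2 / (t * (1 - t)) \<ge> 0"
      using t by simp
    ultimately show ?thesis
      unfolding E_def [symmetric] k_def by linarith
  qed
  ultimately show ?thesis
    by blast
qed

text \<open>One inequality suffices, since exchanging two points off the facet gives equality of
  their levels. Under the negated claim \<open>p\<close> is the farther point and \<open>q\<close>
  the nearer one.\<close>

lemma exact_facet_levels_le:
  fixes S :: "(real ^ 'n::finite) set"
  assumes S: "exact_set S" and F: "F facet_of convex hull S"
    and ab: "convex hull S \<subseteq> {x. a \<bullet> x \<le> b}" "F = convex hull S \<inter> {x. a \<bullet> x = b}"
    and p: "p \<in> S" and q: "q \<in> S" "a \<bullet> q < b"
  shows "a \<bullet> q \<le> a \<bullet> p"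
proof (rule ccontr)
  assume "\<not> ?thesis"
  then have pq: "a \<bullet> p < a \<bullet> q"
    by simp
  define T where "T = S \<inter> F"
  have fin: "finite S" and TH: "TH1 (vanishing_ideal S) = convex hull S"
    using S by (auto simp: exact_set_def)
  have "finite T" "T \<subseteq> S"
    using fin by (auto simp: T_def)
  have aT: "a \<bullet> s = b" if "s \<in> T" for s
    using that by (simp add: T_def ab)
  have F_hull: "F = convex hull T"
    unfolding T_def
    using face_of_convex_hull_eq [OF finite_imp_compact [OF fin]] F facet_of_imp_face_of by blast
  have "F \<noteq> {}"
    using F by (simp add: facet_of_def)
  then have "T \<noteq> {}"
    using F_hull by auto
  have "p \<notin> T" "q \<notin> T" "p \<noteq> q"
    using aT q pq by force+
  have "p \<notin> affine hull T"
  proof -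
    have "affine hull T \<subseteq> {x. a \<bullet> x = b}"
      using aT by (intro hull_minimal) (auto simp: affine_hyperplane)
    then show ?thesis
      using pq q by auto
  qed
  \<comment> \<open>A facet has codimension 1, so one point outside its affine hull already
    completes it to the affine hull of \<open>S\<close>; hence \<open>q\<close> is an affine
    combination of \<open>p\<close> and \<open>T\<close>.\<close>
  then have "aff_dim (insert p T) = aff_dim S"
    using F by (simp add: aff_dim_insert facet_of_def F_hull aff_dim_convex_hull)
  then have "affine hull (insert p T) = affine hull S"
    using aff_dim_eq_full_gen [of "insert p T" S] \<open>T \<subseteq> S\<close> p by simp
  then have "q \<in> affine hull (insert p T)"
    using q by (simp add: hull_inc)
  then obtain u where u: "sum u (insert p T) = 1" "(\<Sum>v\<in>insert p T. u v *\<^sub>R v) = q"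
    using affine_hull_finite [of "insert p T"] \<open>finite T\<close> by auto
  define r where "r = u p"
  have u1: "r + sum u T = 1" and uq: "q = r *\<^sub>R p + (\<Sum>v\<in>T. u v *\<^sub>R v)"
    using u \<open>finite T\<close> \<open>p \<notin> T\<close> by (simp_all add: r_def)
  have affq: "c \<bullet> q + d = r * (c \<bullet> p + d) + (\<Sum>v\<in>T. u v * (c \<bullet> v + d))" for c d
  proof -
    have "d = r * d + sum u T * d"
      using u1 by (metis distrib_right mult_1)
    then show ?thesis
      by (simp add: uq inner_add_right inner_sum_right distrib_left sum.distrib sum_distrib_right)
  qed
  \<comment> \<open>The functional \<open>b - a \<bullet> x\<close> vanishes on \<open>T\<close>, so
    the coefficient of \<open>p\<close> is exactly the ratio of the two distances.\<close>
  have r: "b - a \<bullet> q = r * (b - a \<bullet> p)"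
    using affq [of "- a" b] aT by simp
  have "0 < r * (b - a \<bullet> p)" "r * (b - a \<bullet> p) < 1 * (b - a \<bullet> p)"
    unfolding r [symmetric] using q pq by simp_all
  moreover have "0 < b - a \<bullet> p"
    using q pq by simp
  ultimately have "0 < r" "r < 1"
    using zero_less_mult_pos2 [of r] mult_right_less_imp_less [of r "b - a \<bullet> p" 1] by auto
  obtain k M where k: "0 < k" "k < r" and "1 < M"
    and kM: "\<And>X h. k * X\<^sup>2 - (r * X + (\<Sum>s\<in>T. u s * h s))\<^sup>2 + M * (\<Sum>s\<in>T. (h s)\<^sup>2) \<ge> 0"
    using square_perturbation_bound [OF \<open>0 < r\<close> \<open>r < 1\<close> \<open>finite T\<close>, of u] by blast
  define W where "W = k - 1 + M * card T"
  \<comment> \<open>The facet contains a point of \<open>S\<close>, so its mass outweighs the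
    \<open>-1\<close> at \<open>q\<close> and normalisation by \<open>W\<close> is possible.\<close>
  have "1 * 1 < M * card T"
    using \<open>1 < M\<close> \<open>finite T\<close> \<open>T \<noteq> {}\<close>
    by (intro mult_less_le_imp_less) (auto simp: Suc_le_eq card_gt_0_iff)
  then have "W > 0"
    using k by (simp add: W_def)
  define w where "w s = (if s \<in> T then M else if s = p then k else if s = q then -1 else 0) / W" for s
  \<comment> \<open>Stated for arbitrary \<open>\<phi>\<close> to cover the total mass, the moments
    of squares and the distance of the barycentre from the facet.\<close>
  have w_sum: "(\<Sum>s\<in>S. w s * \<phi> s) = (k * \<phi> p - \<phi> q + M * sum \<phi> T) / W" for \<phi> :: "real ^ 'n \<Rightarrow> real"
  proof -
    have "(\<Sum>s\<in>S. w s * \<phi> s) = (\<Sum>s\<in>insert p (insert q T). w s * \<phi> s)"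
      using fin p q \<open>T \<subseteq> S\<close> by (intro sum.mono_neutral_right) (auto simp: w_def)
    also have "\<dots> = w p * \<phi> p + (w q * \<phi> q + (\<Sum>s\<in>T. w s * \<phi> s))"
      using \<open>finite T\<close> \<open>p \<notin> T\<close> \<open>q \<notin> T\<close> \<open>p \<noteq> q\<close> by simp
    also have "(\<Sum>s\<in>T. w s * \<phi> s) = M / W * sum \<phi> T"
      by (simp add: w_def sum_distrib_left)
    finally show ?thesis
      using \<open>p \<notin> T\<close> \<open>q \<notin> T\<close> \<open>p \<noteq> q\<close> by (simp add: w_def add_divide_distrib diff_divide_distrib)
  qed
  define x where "x = (\<Sum>s\<in>S. w s *\<^sub>R s)"
  have w1: "sum w S = 1"
    using w_sum [of "\<lambda>_. 1"] \<open>W > 0\<close> by (simp add: W_def)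
  have "x \<in> TH1 (vanishing_ideal S)"
    unfolding x_def
  proof (rule signed_moment_in_TH1 [OF fin w1])
    fix c d
    have "0 \<le> k * (c \<bullet> p + d)\<^sup>2 - (c \<bullet> q + d)\<^sup>2 + M * (\<Sum>s\<in>T. (c \<bullet> s + d)\<^sup>2)"
      unfolding affq [of c d] by (rule kM)
    then show "0 \<le> (\<Sum>s\<in>S. w s * (c \<bullet> s + d)\<^sup>2)"
      using \<open>W > 0\<close> by (simp add: w_sum)
  qed
  then have "a \<bullet> x \<le> b"
    using TH ab by auto
  have "b - a \<bullet> x = (\<Sum>s\<in>S. w s * (b - a \<bullet> s))"
    using w1 by (simp add: x_def inner_sum_right right_diff_distrib sum_subtractf flip: sum_distrib_right)
  also have "\<dots> = (k * (b - a \<bullet> p) - (b - a \<bullet> q)) / W"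
    using aT by (simp add: w_sum)
  also have "\<dots> = (k - r) * (b - a \<bullet> p) / W"
    by (simp add: r left_diff_distrib)
  also have "\<dots> < 0"
    using k q pq \<open>W > 0\<close> by (intro divide_neg_pos mult_neg_pos) auto
  finally show False
    using \<open>a \<bullet> x \<le> b\<close> by simp
qed

section \<open>Zero-one functionals, vertices and coordinates\<close>

lemma exact_zero_one_separation:
  fixes S :: "(real ^ 'n::finite) set"
  assumes S: "exact_set S" and xy: "x \<in> affine hull S" "y \<in> affine hull S" "x \<noteq> y"
  obtains a b where "\<And>s. s \<in> S \<Longrightarrow> a \<bullet> s + b \<in> {0, 1}" "a \<bullet> x \<noteq> a \<bullet> y"
proof -
  let ?P = "convex hull S"
  have fin: "finite S"
    using S by (simp add: exact_set_def)
  have poly: "polyhedron ?P"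
    by (simp add: fin polytope_convex_hull polytope_imp_polyhedron)
  have "S \<noteq> {}"
    using xy by auto
  then obtain z where z: "z \<in> rel_interior ?P"
    using rel_interior_eq_empty [of ?P] by auto
  have "z \<in> affine hull S"
    using z rel_interior_subset [of ?P] convex_hull_subset_affine_hull [of S] by blast
  then have "z + 1 *\<^sub>R (x - y) \<in> affine hull S"
    using xy by (intro mem_affine_3_minus) auto
  then obtain t where "t > 0" and zt: "z + t *\<^sub>R (x - y) \<in> rel_frontier ?P"
    using ray_to_rel_frontier [of ?P z "x - y"] z xy fin
    by (auto simp: finite_imp_bounded_convex_hull)
  then obtain F where F: "F facet_of ?P" "z + t *\<^sub>R (x - y) \<in> F"
    using rel_frontier_of_polyhedron [OF poly] by blast
  have face: "F face_of ?P"
    using F by (simp add: facet_of_imp_face_of)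
  have "F exposed_face_of ?P"
    using face exposed_face_of_polyhedron [OF poly] by blast
  then obtain a b where ab: "?P \<subseteq> {x. a \<bullet> x \<le> b}" "F = ?P \<inter> {x. a \<bullet> x = b}"
    by (auto simp: exposed_face_of_def)
  \<comment> \<open>A facet is proper and so misses the relative interior: \<open>z\<close> lies
    strictly below level \<open>b\<close>. The ray in direction \<open>x - y\<close> climbs to that
    level, so \<open>a\<close> separates \<open>x\<close> from \<open>y\<close>.\<close>
  have "F \<noteq> ?P"
    using F(1) by auto
  then have "F \<inter> rel_interior ?P = {}"
    using face face_of_disjoint_rel_interior by blast
  then have "a \<bullet> z < b"
    using z ab rel_interior_subset [of ?P] by force
  moreover have "a \<bullet> z + t * (a \<bullet> x - a \<bullet> y) = b"
    using F(2) ab by (simp add: inner_add_right inner_diff_right)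
  ultimately have neq: "a \<bullet> x \<noteq> a \<bullet> y"
    by auto
  have le: "a \<bullet> s \<le> b" if "s \<in> S" for s
    using that ab(1) hull_subset by fast
  have "\<exists>p\<in>S. a \<bullet> p < b"
  proof (rule ccontr)
    assume "\<not> ?thesis"
    then have "a \<bullet> z \<ge> b"
      using z rel_interior_subset [of ?P] by (intro convex_hull_affine_ge [of z S]) force+
    with \<open>a \<bullet> z < b\<close> show False
      by simp
  qed
  then obtain p where p: "p \<in> S" "a \<bullet> p < b"
    by blast
  \<comment> \<open>By the two-level property this is the common distance of all points of
    \<open>S\<close> off the facet; the normalised functional is 0 on the facet and 1 at those
    points.\<close>
  define m where "m = b - a \<bullet> p"
  have "m > 0"
    using p by (simp add: m_def)
  have "(- inverse m *\<^sub>R a) \<bullet> s + b / m \<in> {0, 1}" if s: "s \<in> S" for s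
  proof (cases "a \<bullet> s = b")
    case True
    then show ?thesis
      by (simp add: field_simps)
  next
    case False
    then have "a \<bullet> s < b"
      using le s by force
    then have "a \<bullet> s = a \<bullet> p"
      using exact_facet_levels_le [OF S F(1) ab] p s by (meson order_antisym)
    then show ?thesis
      using \<open>m > 0\<close> by (simp add: m_def field_simps)
  qed
  moreover have "(- inverse m *\<^sub>R a) \<bullet> x \<noteq> (- inverse m *\<^sub>R a) \<bullet> y"
    using neq \<open>m > 0\<close> by simp
  ultimately show thesis
    by (rule that)
qed

text \<open>On the hull a zero-one functional ranges in [0, 1], and at \<open>s\<close> it attains
  an end of that interval. It must then be constant on any segment with \<open>s\<close> in its
  interior, so it cannot separate the endpoints.\<close>

lemma exact_extreme_point:
  assumes S: "exact_set S" and s: "s \<in> S"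
  shows "s extreme_point_of convex hull S"
  unfolding extreme_point_of_def
proof (intro conjI ballI notI)
  show "s \<in> convex hull S"
    using s by (rule hull_inc)
  fix u v assume uv: "u \<in> convex hull S" "v \<in> convex hull S" and "s \<in> open_segment u v"
  then obtain t where "u \<noteq> v" and t: "0 < t" "t < 1" "s = (1 - t) *\<^sub>R u + t *\<^sub>R v"
    by (auto simp: in_segment)
  obtain a b where ab: "\<And>s. s \<in> S \<Longrightarrow> a \<bullet> s + b \<in> {0, 1}" "a \<bullet> u \<noteq> a \<bullet> v"
    using exact_zero_one_separation [OF S _ _ \<open>u \<noteq> v\<close>] uv convex_hull_subset_affine_hull by blast
  have bounds: "0 \<le> a \<bullet> z + b \<and> a \<bullet> z + b \<le> 1" if "z \<in> convex hull S" for z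
    using convex_hull_affine_ge [OF that, of "- b" a] convex_hull_affine_le [OF that, of a "1 - b"] ab(1)
    by force
  have eq: "a \<bullet> s + b = (1 - t) * (a \<bullet> u + b) + t * (a \<bullet> v + b)"
    unfolding t(3) by (simp add: inner_add_right algebra_simps)
  consider "a \<bullet> s + b = 0" | "a \<bullet> s + b = 1"
    using ab(1) s by blast
  then show False
  proof cases
    case 1
    then have "(1 - t) * (a \<bullet> u + b) = 0" "t * (a \<bullet> v + b) = 0"
      using eq t bounds [OF uv(1)] bounds [OF uv(2)]
      by (metis add_nonneg_eq_0_iff diff_ge_0_iff_ge less_imp_le mult_nonneg_nonneg)+
    then show False
      using t ab(2) by auto
  next
    case 2
    then have "(1 - t) * (1 - (a \<bullet> u + b)) + t * (1 - (a \<bullet> v + b)) = 0"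
      using eq by (simp add: algebra_simps)
    then have "(1 - t) * (1 - (a \<bullet> u + b)) = 0" "t * (1 - (a \<bullet> v + b)) = 0"
      using t bounds [OF uv(1)] bounds [OF uv(2)]
      by (metis add_nonneg_eq_0_iff diff_ge_0_iff_ge less_imp_le mult_nonneg_nonneg)+
    then show False
      using t ab(2) by auto
  qed
qed

text \<open>A maximal independent set of linear parts of zero-one functionals has at most
  \<open>CARD('n)\<close> members, so these fit into the coordinates of the same space, and it still
  separates points.\<close>

lemma exact_zero_one_coordinates:
  fixes S :: "(real ^ 'n::finite) set"
  assumes S: "exact_set S"
  obtains L :: "real ^ 'n \<Rightarrow> real ^ 'n" and c
  where "linear L" "inj_on (\<lambda>x. L x + c) (affine hull S)"
    "\<And>s i. s \<in> S \<Longrightarrow> (L s + c) $ i \<in> {0, 1}"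
proof -
  define V where "V = {a. \<exists>b. \<forall>s\<in>S. a \<bullet> s + b \<in> {0, 1}}"
  obtain B where B: "B \<subseteq> V" "independent B" "V \<subseteq> span B"
    by (rule maximal_independent_subset)
  have "finite B" "card B \<le> CARD('n)"
    using independent_bound [OF B(2)] by simp_all
  then obtain e :: "real ^ 'n \<Rightarrow> 'n" where e: "inj_on e B"
    using card_le_inj [of B "UNIV :: 'n set"] by auto
  \<comment> \<open>Coordinates left over receive the zero functional, which lies in
    \<open>V\<close> and keeps the zero-one condition.\<close>
  define A where "A i = (if i \<in> e ` B then inv_into B e i else 0)" for i
  have "0 \<in> V"
    by (auto simp: V_def intro: exI [of _ 0])
  then have "A i \<in> V" for i
    using B(1) by (auto simp: A_def inv_into_into)
  then have "\<forall>i. \<exists>b. \<forall>s\<in>S. A i \<bullet> s + b \<in> {0, 1}"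
    by (simp add: V_def)
  then obtain c where c: "\<And>i s. s \<in> S \<Longrightarrow> A i \<bullet> s + c i \<in> {0, 1}"
    by metis
  define L where "L x = (\<chi> i. A i \<bullet> x)" for x
  have "linear L"
    by (rule linearI) (simp_all add: L_def vec_eq_iff inner_add_right)
  moreover have "inj_on (\<lambda>x. L x + (\<chi> i. c i)) (affine hull S)"
  proof (rule inj_onI, rule ccontr)
    fix x y assume xy: "x \<in> affine hull S" "y \<in> affine hull S" "x \<noteq> y"
      and "L x + (\<chi> i. c i) = L y + (\<chi> i. c i)"
    then have Axy: "A i \<bullet> (x - y) = 0" for i
      by (simp add: L_def vec_eq_iff inner_diff_right)
    have "a \<bullet> (x - y) = 0" if "a \<in> B" for a
      using Axy [of "e a"] e that by (simp add: A_def)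
    \<comment> \<open>Functionals vanishing on \<open>x - y\<close> form a subspace, so vanishing
      spreads from \<open>B\<close> to all of \<open>V\<close>, against separation.\<close>
    then have "B \<subseteq> {a. a \<bullet> (x - y) = 0}"
      by blast
    then have "span B \<subseteq> {a. a \<bullet> (x - y) = 0}"
      by (rule span_minimal) (auto simp: subspace_def inner_add_left)
    moreover obtain a b where "\<And>s. s \<in> S \<Longrightarrow> a \<bullet> s + b \<in> {0, 1}" "a \<bullet> x \<noteq> a \<bullet> y"
      using exact_zero_one_separation [OF S xy] by blast
    then have "a \<in> V" "a \<bullet> (x - y) \<noteq> 0"
      by (auto simp: V_def inner_diff_right)
    ultimately show False
      using B(3) by blast
  qed
  moreover have "(L s + (\<chi> i. c i)) $ i \<in> {0, 1}" if "s \<in> S" for s i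
    using c [OF that] by (simp add: L_def)
  ultimately show thesis
    by (rule that)
qed

section \<open>Assembly of the four claims\<close>

theorem corollary4p5:
  fixes S S' :: "(real ^ 'n::finite) set"
  assumes "exact_set S" and "exact_set S'"
  shows "(\<forall>x\<in>S. x \<in> vertices (convex hull S)) \<and>
    (\<forall>F. F face_of (convex hull S) \<longrightarrow> exact_set (vertices F)) \<and>
    exact_set (vec_Times S S') \<and>
    (\<exists>Q :: (real ^ 'n) set. zero_one_polytope Q \<and> affinely_equivalent (convex hull S) Q)"
proof (intro conjI ballI allI impI)
  show "exact_set (vec_Times S S')"
    using assms by (rule exact_vec_Times)
  show "x \<in> vertices (convex hull S)" if "x \<in> S" for x
    using exact_extreme_point [OF assms(1) that] by (simp add: vertices_def)
  show "exact_set (vertices F)" if F: "F face_of convex hull S" for F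
  proof -
    \<comment> \<open>Extreme points of a face are the extreme points of the hull lying in it, and
      those of the hull are precisely the points of \<open>S\<close>.\<close>
    have "vertices F = S \<inter> F"
      using extreme_point_of_face [OF F] exact_extreme_point [OF assms(1)]
        extreme_point_of_convex_hull [of _ S]
      by (auto simp: vertices_def)
    then show ?thesis
      using exact_set_face [OF assms(1) F] by simp
  qed
  obtain L :: "real ^ 'n \<Rightarrow> real ^ 'n" and c where L: "linear L"
    and inj: "inj_on (\<lambda>x. L x + c) (affine hull S)"
    and coord: "\<And>s i. s \<in> S \<Longrightarrow> (L s + c) $ i \<in> {0, 1}"
    using exact_zero_one_coordinates [OF assms(1)] by blast
  let ?\<phi> = "\<lambda>x. L x + c"
  have hull: "?\<phi> ` (convex hull S) = convex hull (?\<phi> ` S)"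
  proof -
    have "?\<phi> ` U = (\<lambda>x. c + x) ` L ` U" for U
      by (simp add: image_image add.commute)
    then show ?thesis
      by (simp add: convex_hull_translation convex_hull_linear_image [OF L])
  qed
  show "\<exists>Q :: (real ^ 'n) set. zero_one_polytope Q \<and> affinely_equivalent (convex hull S) Q"
  proof (intro exI conjI)
    have "finite S"
      using assms(1) by (simp add: exact_set_def)
    then have "polytope (?\<phi> ` (convex hull S))"
      by (simp add: hull polytope_convex_hull)
    moreover have "v $ i \<in> {0, 1}" if "v \<in> vertices (?\<phi> ` (convex hull S))" for v i
    proof -
      have "v \<in> ?\<phi> ` S"
        using that unfolding vertices_def hull by (blast dest: extreme_point_of_convex_hull)
      then show ?thesis
        using coord by blast
    qed
    ultimately show "zero_one_polytope (?\<phi> ` (convex hull S))"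
      unfolding zero_one_polytope_def by blast
    have "inj_on ?\<phi> (convex hull S)"
      using inj convex_hull_subset_affine_hull by (rule inj_on_subset)
    then show "affinely_equivalent (convex hull S) (?\<phi> ` (convex hull S))"
      unfolding affinely_equivalent_def using L inj_on_imp_bij_betw by blast
  qed
qed

end
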